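(* Let $G$ be a connected $d$-regular graph with edge connectivity $\kappa'$. Then $t(G)\ge \kappa'/d$.
   Context: All graphs are finite, undirected and simple. The edge connectivity of $G$ is denoted $\kappa'=\kappa'(G)$, and $c(H)$ denotes the number of components of a graph $H$. The toughness of a connected graph $G$ is $t(G)=\min\left\{\frac{|S|}{c(G-S)}\right\}$, where the minimum is taken over all proper subsets $S\subset V(G)$ such that $c(G-S)>1$; if no such $S$ exists (i.e. $G$ is complete), $t(G)=+\infty$, so that any lower bound on $t(G)$ holds. The quotient $\kappa'/d$ presupposes $d\ge 1$. *)

theory Defs
  imports "HOL-Library.Extended_Real" "Graph_Theory.Digraph_Component"
begin

text \<open>
  Finite simple undirected graphs are instances of the locale \<^locale>\<open>graph\<close>: finite, loopless,
  symmetric digraphs without parallel arcs.  An undirected edge is thus a pair of opposite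
  arcs; where edges have to be counted, it is represented by its set of end vertices.
  The name \<open>connected\<close> is qualified because \<open>Complex_Main\<close> has a topological constant of the same name.
\<close>

definition regular :: "nat \<Rightarrow> ('a, 'b) pre_digraph \<Rightarrow> bool" where
  "regular d G \<longleftrightarrow> (\<forall>v \<in> verts G. out_degree G v = d)"

definition edges :: "('a, 'b) pre_digraph \<Rightarrow> 'a set set" where
  "edges G = (\<lambda>a. {tail G a, head G a}) ` arcs G"

definition del_edges :: "('a, 'b) pre_digraph \<Rightarrow> 'a set set \<Rightarrow> ('a, 'b) pre_digraph" where
  "del_edges G F = G\<lparr> arcs := {a \<in> arcs G. {tail G a, head G a} \<notin> F} \<rparr>"

text \<open>
  A single vertex cannot be disconnected by deleting edges; by the usual convention its edge
  connectivity is 0.  With at least two vertices, deleting all edges disconnects, so the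
  minimum is over a nonempty set.
\<close>

definition edge_connectivity :: "('a, 'b) pre_digraph \<Rightarrow> nat" where
  "edge_connectivity G =
     (if card (verts G) \<le> 1 then 0
      else Min {card F | F. F \<subseteq> edges G \<and> \<not> Digraph_Component.connected (del_edges G F)})"

definition del_verts :: "('a, 'b) pre_digraph \<Rightarrow> 'a set \<Rightarrow> ('a, 'b) pre_digraph" where
  "del_verts G S = G \<restriction> (verts G - S)"

text \<open>
  In a symmetric digraph reachability is symmetric, so the strongly connected components
  are the components of the undirected graph.
\<close>

definition num_components :: "('a, 'b) pre_digraph \<Rightarrow> nat" where
  "num_components H = card (pre_digraph.sccs H)"

definition disconnecting_sets :: "('a, 'b) pre_digraph \<Rightarrow> 'a set set" where
  "disconnecting_sets G = {S. S \<subset> verts G \<and> num_components (del_verts G S) > 1}"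

definition toughness :: "('a, 'b) pre_digraph \<Rightarrow> ereal" where
  "toughness G =
     (if disconnecting_sets G = {} then \<infinity>
      else ereal (Min {real (card S) / real (num_components (del_verts G S)) | S.
                         S \<in> disconnecting_sets G}))"

end

theory Submission
  imports Defs
begin

text \<open>
  Let \<open>S\<close> be a disconnecting set of \<open>G\<close> and \<open>c\<close> the number of components of \<open>G - S\<close>.  The theorem is
  a double count of the arcs that lead from \<open>S\<close> into \<open>G - S\<close>.

  All edges that leave a component \<open>C\<close> of \<open>G - S\<close> end in \<open>S\<close>, and deleting them separates \<open>C\<close> from the
  rest of \<open>G\<close>.  So at least \<open>\<kappa>'\<close> arcs lead from \<open>S\<close> to \<open>C\<close>
  (\<open>edge_connectivity_le_card_arcs_between\<close>).  Components are disjoint, hence these arcs are different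
  for different components, and in total there are at least \<open>c \<kappa>'\<close> of them.  On the other hand only
  \<open>d |S|\<close> arcs start in \<open>S\<close>.  Hence \<open>c \<kappa>' \<le> d |S|\<close>, that is, \<open>\<kappa>' / d \<le> |S| / c\<close>, for every
  disconnecting set \<open>S\<close>.
\<close>

definition arcs_between :: "('a, 'b) pre_digraph \<Rightarrow> 'a set \<Rightarrow> 'a set \<Rightarrow> 'b set" where
  "arcs_between G S C = {a \<in> arcs G. tail G a \<in> S \<and> head G a \<in> C}"

lemma reachable_closed:
  assumes "u \<rightarrow>\<^sup>*\<^bsub>H\<^esub> v" and "u \<in> C"
    and closed: "\<And>x y. x \<in> C \<Longrightarrow> x \<rightarrow>\<^bsub>H\<^esub> y \<Longrightarrow> y \<in> C"
  shows "v \<in> C"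
proof -
  have "(u, v) \<in> (arcs_ends H)\<^sup>*"
    using assms(1) by (rule reachable_rtranclI)
  then show ?thesis
    by (induction rule: rtrancl_induct) (use assms(2) closed in auto)
qed

lemma not_connected_if_no_crossing_arc:
  assumes "u \<in> C" "u \<in> verts H" "v \<in> verts H" "v \<notin> C"
    and no_crossing: "\<And>a. a \<in> arcs H \<Longrightarrow> tail H a \<in> C \<longleftrightarrow> head H a \<in> C"
  shows "\<not> Digraph_Component.connected H"
proof
  assume "Digraph_Component.connected H"
  then have "u \<rightarrow>\<^sup>*\<^bsub>mk_symmetric H\<^esub> v"
    using assms by (auto simp: Digraph_Component.connected_def strongly_connected_def)
  then have "v \<in> C"
    by (rule reachable_closed) (use assms in \<open>auto simp: parcs_mk_symmetric\<close>)
  then show False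
    using assms by blast
qed

lemma (in fin_digraph) edge_connectivity_le_card_disconnecting_edges:
  assumes "card (verts G) > 1" "F \<subseteq> edges G"
    and "\<not> Digraph_Component.connected (del_edges G F)"
  shows "edge_connectivity G \<le> card F"
proof -
  let ?X = "{card F | F. F \<subseteq> edges G \<and> \<not> Digraph_Component.connected (del_edges G F)}"
  have "finite (edges G)"
    by (simp add: edges_def)
  then have "finite (card ` Pow (edges G))"
    by simp
  then have "finite ?X"
    by (rule rev_finite_subset) auto
  moreover have "card F \<in> ?X"
    using assms by blast
  ultimately have "Min ?X \<le> card F"
    by (rule Min_le)
  then show ?thesis
    using assms(1) by (simp add: edge_connectivity_def)
qed

text \<open>
  If only vertices of \<open>S\<close> are joined to \<open>C\<close> from outside, then the edges carried by the arcs from \<open>S\<close>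
  to \<open>C\<close> are the whole edge boundary of \<open>C\<close>, since symmetry turns an arc that leaves \<open>C\<close> into one
  that enters it with the same ends.  An edge needs one such arc at least, so the boundary is no
  larger than the set of these arcs.
\<close>

lemma (in graph) edge_connectivity_le_card_arcs_between:
  assumes "C \<noteq> {}" "C \<subset> verts G"
    and entering: "\<And>a. a \<in> arcs G \<Longrightarrow> head G a \<in> C \<Longrightarrow> tail G a \<in> S \<union> C"
  shows "edge_connectivity G \<le> card (arcs_between G S C)"
proof -
  define F where "F = (\<lambda>a. {tail G a, head G a}) ` arcs_between G S C"
  have fin: "finite (arcs_between G S C)"
    unfolding arcs_between_def by simp
  obtain u v where uv: "u \<in> C" "v \<in> verts G" "v \<notin> C"
    using assms(1,2) by blast
  have "u \<in> verts G"
    using uv assms(2) by blast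
  have "card {u, v} \<le> card (verts G)"
    by (rule card_mono) (use uv \<open>u \<in> verts G\<close> in auto)
  moreover have "u \<noteq> v"
    using uv by blast
  ultimately have "card (verts G) > 1"
    by simp
  have entering_deleted: "{tail G a, head G a} \<in> F"
    if "a \<in> arcs G" "head G a \<in> C" "tail G a \<notin> C" for a
    unfolding F_def by (rule imageI) (use entering that in \<open>auto simp: arcs_between_def\<close>)
  have no_crossing: "tail G a \<in> C \<longleftrightarrow> head G a \<in> C"
    if a: "a \<in> arcs G" "{tail G a, head G a} \<notin> F" for a
  proof -
    obtain b where b: "b \<in> arcs G" "tail G a = head G b" "head G a = tail G b"
      using sym_arcs a(1) unfolding symmetric_conv by blast
    then show ?thesis
      using entering_deleted[OF a(1)] entering_deleted[OF b(1)] a(2)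
      by (auto simp: insert_commute)
  qed
  have "\<not> Digraph_Component.connected (del_edges G F)"
    by (rule not_connected_if_no_crossing_arc[of u C _ v])
       (use uv \<open>u \<in> verts G\<close> no_crossing in \<open>auto simp: del_edges_def\<close>)
  moreover have "F \<subseteq> edges G"
    unfolding F_def edges_def arcs_between_def by blast
  ultimately have "edge_connectivity G \<le> card F"
    using \<open>card (verts G) > 1\<close> by (intro edge_connectivity_le_card_disconnecting_edges) auto
  also have "\<dots> \<le> card (arcs_between G S C)"
    unfolding F_def by (rule card_image_le[OF fin])
  finally show ?thesis .
qed

lemma (in sym_digraph) adjacent_in_same_sccs_verts:
  assumes "C \<in> sccs_verts" "a \<in> arcs G" "head G a \<in> C"
  shows "tail G a \<in> C"
proof -
  have "tail G a \<rightarrow>\<^bsub>G\<^esub> head G a"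
    using assms(2) by (rule in_arcs_imp_in_arcs_ends)
  then have "tail G a \<rightarrow>\<^sup>*\<^bsub>G\<^esub> head G a"
    by (rule reachable_adjI)
  moreover from this have "head G a \<rightarrow>\<^sup>*\<^bsub>G\<^esub> tail G a"
    by (rule symmetric_reachable')
  ultimately show ?thesis
    using assms(1,3) unfolding in_sccs_verts_conv_reachable by blast
qed

lemma (in fin_digraph) card_arcs_with_tail_in_le:
  assumes "regular d G" "S \<subseteq> verts G"
  shows "card {a \<in> arcs G. tail G a \<in> S} \<le> d * card S"
proof -
  have "finite S"
    using assms(2) by (rule finite_subset) simp
  have "{a \<in> arcs G. tail G a \<in> S} = (\<Union>v\<in>S. out_arcs G v)"
    by auto
  then have "card {a \<in> arcs G. tail G a \<in> S} \<le> (\<Sum>v\<in>S. out_degree G v)"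
    using card_UN_le[OF \<open>finite S\<close>, of "out_arcs G"] by (simp add: out_degree_def)
  also have "\<dots> = (\<Sum>v\<in>S. d)"
    by (rule sum.cong) (use assms(1,2) in \<open>auto simp: regular_def\<close>)
  finally show ?thesis
    by (simp add: mult.commute)
qed

text \<open>
  Both sides bound the number of arcs from \<open>S\<close> to \<open>G - S\<close>: the left one counts them by the component
  that contains the head, the right one by the tail.  A component can be separated from something
  because \<open>G - S\<close> has a second one, even when \<open>S\<close> is empty.
\<close>

lemma (in graph) num_components_times_edge_connectivity_le:
  assumes reg: "regular d G" and S: "S \<in> disconnecting_sets G"
  shows "num_components (del_verts G S) * edge_connectivity G \<le> d * card S"
proof -
  define H where "H = del_verts G S"
  have S_sub: "S \<subseteq> verts G" and more: "num_components H > 1"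
    using S by (auto simp: disconnecting_sets_def H_def)
  have ind: "induced_subgraph H G"
    unfolding H_def del_verts_def by (rule induced_induce) blast
  interpret H: sym_digraph H
    unfolding sym_digraph_def sym_digraph_axioms_def
    using wellformed_induce_subgraph induced_graph_imp_symmetric[OF sym_arcs ind]
    by (auto simp: H_def del_verts_def)
  have vertsH: "verts H = verts G - S"
    by (simp add: H_def del_verts_def)
  have num: "num_components H = card H.sccs_verts"
    by (simp add: num_components_def H.card_sccs_verts)
  \<comment> \<open>An infinite set would have cardinality 0, but there are at least two components.\<close>
  then have fin: "finite H.sccs_verts"
    using more by (metis card.infinite not_one_less_zero)
  have bound: "edge_connectivity G \<le> card (arcs_between G S C)" if C: "C \<in> H.sccs_verts" for C
  proof (rule edge_connectivity_le_card_arcs_between)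
    show "C \<noteq> {}"
      using C by (simp add: H.in_sccs_verts_conv_reachable)
    have C_sub: "C \<subseteq> verts G - S"
      using H.sccs_verts_subsets[OF C] by (simp add: vertsH)
    \<comment> \<open>A second component \<open>D\<close> provides vertices outside \<open>C\<close>.\<close>
    obtain D where D: "D \<in> H.sccs_verts" "D \<noteq> C"
    proof -
      have "\<not> H.sccs_verts \<subseteq> {C}"
        using more num card_mono[of "{C}" H.sccs_verts] by auto
      then show ?thesis
        using that by blast
    qed
    have "D \<noteq> {}" "D \<subseteq> verts G - S"
      using D(1) H.sccs_verts_subsets[OF D(1)]
      by (auto simp: H.in_sccs_verts_conv_reachable vertsH)
    moreover have "D \<inter> C = {}"
      using D C H.sccs_verts_disjoint by blast
    ultimately show "C \<subset> verts G"
      using C_sub by blast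
    show "tail G a \<in> S \<union> C" if a: "a \<in> arcs G" "head G a \<in> C" for a
    proof (cases "tail G a \<in> S")
      case False
      then have "a \<in> arcs H"
        using a C_sub by (auto simp: H_def del_verts_def)
      then show ?thesis
        using H.adjacent_in_same_sccs_verts[OF C] a(2) by (auto simp: H_def del_verts_def)
    qed simp
  qed
  have "num_components H * edge_connectivity G = (\<Sum>C\<in>H.sccs_verts. edge_connectivity G)"
    by (simp add: num)
  also have "\<dots> \<le> (\<Sum>C\<in>H.sccs_verts. card (arcs_between G S C))"
    by (rule sum_mono) (rule bound)
  also have "\<dots> = card (\<Union>C\<in>H.sccs_verts. arcs_between G S C)"
  proof (rule card_UN_disjoint[symmetric])
    show "\<forall>C\<in>H.sccs_verts. \<forall>D\<in>H.sccs_verts. C \<noteq> D \<longrightarrow>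
        arcs_between G S C \<inter> arcs_between G S D = {}"
      using H.sccs_verts_disjoint by (fastforce simp: arcs_between_def)
  qed (auto simp: fin arcs_between_def)
  also have "\<dots> \<le> card {a \<in> arcs G. tail G a \<in> S}"
    by (rule card_mono) (auto simp: arcs_between_def)
  also have "\<dots> \<le> d * card S"
    by (rule card_arcs_with_tail_in_le[OF reg S_sub])
  finally show ?thesis
    by (simp add: H_def)
qed

theorem theorem1p12:
  fixes G :: "('a, 'b) pre_digraph" and d :: nat
  assumes "graph G"
    and "Digraph_Component.connected G"
    and "regular d G"
    and "d \<ge> 1"
  shows "toughness G \<ge> ereal (real (edge_connectivity G) / real d)"
proof (cases "disconnecting_sets G = {}")
  case True
  then show ?thesis
    by (simp add: toughness_def)
next
  case False
  interpret graph G
    by (rule assms(1))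
  let ?ratio = "\<lambda>S. real (card S) / real (num_components (del_verts G S))"
  let ?T = "{?ratio S | S. S \<in> disconnecting_sets G}"
  have "disconnecting_sets G \<subseteq> Pow (verts G)"
    by (auto simp: disconnecting_sets_def)
  then have "finite (disconnecting_sets G)"
    by (rule finite_subset) simp
  then have "finite ?T"
    by simp
  moreover have "?T \<noteq> {}"
    using False by blast
  moreover have "real (edge_connectivity G) / real d \<le> ?ratio S" if S: "S \<in> disconnecting_sets G" for S
  proof -
    let ?c = "num_components (del_verts G S)"
    have "?c > 0"
      using S by (simp add: disconnecting_sets_def)
    have "real (?c * edge_connectivity G) \<le> real (d * card S)"
      using num_components_times_edge_connectivity_le[OF assms(3) S] by (rule of_nat_mono)
    then show ?thesis
      using \<open>?c > 0\<close> assms(4) by (simp add: field_simps)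
  qed
  ultimately have "real (edge_connectivity G) / real d \<le> Min ?T"
    by (subst Min_ge_iff) auto
  then show ?thesis
    using False by (simp add: toughness_def)
qed

end
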